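(* Consider an IMEX-MRI-SR method with $s^{\{S\}}$ slow stages, coefficient matrices $\Omega^{\{0\}},\dots,\Omega^{\{n_\Omega-1\}},\Gamma\in\mathbb{R}^{s^{\{S\}}\times s^{\{S\}}}$ and abscissae $c^{\{S\}}\in\mathbb{R}^{s^{\{S\}}}$, whose fast subproblems are solved by one step of a Runge--Kutta method $(A^{\{F\}},b^{\{F\}},c^{\{F\}})$ with $s^{\{F\}}$ stages, and let $\mathbf{A}^{\{F,\nu\}}$, $\mathbf{A}^{\{S,\nu\}}$, $\nu\in\{F,E,I\}$, be its associated GARK matrices (given in the context). If $$\Omega^{\{0\}}\mathbb{1}=c^{\{S\}},\qquad \Omega^{\{k\}}\mathbb{1}=0\ \ (k=1,\dots,n_\Omega-1),\qquad \Gamma\,\mathbb{1}=0,$$ where $\mathbb{1}$ is the vector of ones of length $s^{\{S\}}$, then the method satisfies the GARK internal consistency conditions $$\mathbf{c}^{\{F,F\}}=\mathbf{c}^{\{F,E\}}=\mathbf{c}^{\{F,I\}},\qquad \mathbf{c}^{\{S,F\}}=\mathbf{c}^{\{S,E\}}=\mathbf{c}^{\{S,I\}},$$ where $\mathbf{c}^{\{\sigma,\nu\}}$ denotes the vector of row sums of $\mathbf{A}^{\{\sigma,\nu\}}$ for $\sigma\in\{F,S\}$, $\nu\in\{F,E,I\}$.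
   Context: An IMEX-MRI-SR (implicit-explicit multirate infinitesimal stage-restart) method with $s^{\{S\}}$ slow stages is given by strictly lower-triangular real $s^{\{S\}}\times s^{\{S\}}$ matrices $\Omega^{\{k\}}$, $k=0,\dots,n_\Omega-1$ ($n_\Omega\ge1$), a lower-triangular real $s^{\{S\}}\times s^{\{S\}}$ matrix $\Gamma$ whose first row is zero, and a vector $c^{\{S\}}\in\mathbb{R}^{s^{\{S\}}}$. Put $\overline{\Omega}:=\sum_{k=0}^{n_\Omega-1}\frac{1}{k+1}\Omega^{\{k\}}$ and $C^{\{S\}}:=\operatorname{diag}(c^{\{S\}})$. The fast Runge--Kutta method has $A^{\{F\}}\in\mathbb{R}^{s^{\{F\}}\times s^{\{F\}}}$, $b^{\{F\}},c^{\{F\}}\in\mathbb{R}^{s^{\{F\}}}$, with $c^{\{F\}}=A^{\{F\}}\mathbb{1}$, and is assumed to satisfy the bushy-tree conditions $b^{\{F\},T}c^{\{F\}\times k}=\frac{1}{k+1}$ for $k=0,\dots,n_\Omega-1$. Here $v^{\times k}$ denotes the element-wise $k$-th power of a vector $v$ (with $v^{\times 0}=\mathbb{1}$). With $\otimes$ the Kronecker product, the GARK matrices of the method are $$\mathbf{A}^{\{F,F\}}=C^{\{S\}}\otimes A^{\{F\}}\in\mathbb{R}^{s^{\{S\}}s^{\{F\}}\times s^{\{S\}}s^{\{F\}}},$$ $$\mathbf{A}^{\{F,E\}}=\mathbf{A}^{\{F,I\}}=\sum_{k=0}^{n_\Omega-1}\Omega^{\{k\}}\otimes\big(A^{\{F\}}c^{\{F\}\times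 k}\big)\in\mathbb{R}^{s^{\{S\}}s^{\{F\}}\times s^{\{S\}}},$$ $$\mathbf{A}^{\{S,F\}}=C^{\{S\}}\otimes b^{\{F\},T}\in\mathbb{R}^{s^{\{S\}}\times s^{\{S\}}s^{\{F\}}},\qquad \mathbf{A}^{\{S,E\}}=\overline{\Omega},\qquad \mathbf{A}^{\{S,I\}}=\overline{\Omega}+\Gamma .$$ *)

theory Defs
  imports Complex_Main "Jordan_Normal_Form.Matrix"
begin

section \<open>Matrix and vector notation\<close>

definition ones_vec :: "nat \<Rightarrow> real vec" where
  "ones_vec n = vec n (\<lambda>_. 1)"

text \<open>Element-wise power; \<open>vec_pow v 0\<close> is the vector of ones, also at zero entries of \<open>v\<close>,
  because \<open>0 ^ 0 = 1\<close>.\<close>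

definition vec_pow :: "real vec \<Rightarrow> nat \<Rightarrow> real vec" where
  "vec_pow v k = map_vec (\<lambda>x. x ^ k) v"

definition row_sums :: "real mat \<Rightarrow> real vec" where
  "row_sums A = vec (dim_row A) (\<lambda>i. \<Sum>j<dim_col A. A $$ (i, j))"

text \<open>\<open>mat_sum m n f K\<close> is the sum of the \<open>m \<times> n\<close> matrices \<open>f 0, \<dots>, f (K - 1)\<close>. Matrices whose
  dimension is not part of the type have no type-class addition with a unit, so the library's
  big sum operator is not available for them.\<close>

definition mat_sum :: "nat \<Rightarrow> nat \<Rightarrow> (nat \<Rightarrow> real mat) \<Rightarrow> nat \<Rightarrow> real mat" where
  "mat_sum m n f K = mat m n (\<lambda>(i, j). \<Sum>k<K. f k $$ (i, j))"

text \<open>The block in block-position \<open>(i, j)\<close> of \<open>kronecker A B\<close> is \<open>A $$ (i, j)\<close> times \<open>B\<close>.\<close>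

definition kronecker :: "real mat \<Rightarrow> real mat \<Rightarrow> real mat" where
  "kronecker A B = mat (dim_row A * dim_row B) (dim_col A * dim_col B)
     (\<lambda>(i, j). A $$ (i div dim_row B, j div dim_col B) * B $$ (i mod dim_row B, j mod dim_col B))"

definition col_mat :: "real vec \<Rightarrow> real mat" where
  "col_mat v = mat_of_cols (dim_vec v) [v]"

definition lower_triangular :: "real mat \<Rightarrow> bool" where
  "lower_triangular A \<longleftrightarrow> (\<forall>i<dim_row A. \<forall>j<dim_col A. i < j \<longrightarrow> A $$ (i, j) = 0)"

definition strictly_lower_triangular :: "real mat \<Rightarrow> bool" where
  "strictly_lower_triangular A \<longleftrightarrow> (\<forall>i<dim_row A. \<forall>j<dim_col A. i \<le> j \<longrightarrow> A $$ (i, j) = 0)"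

section \<open>The methods\<close>

text \<open>Only the values \<open>Omega M k\<close> with \<open>k < n_Omega M\<close> are coefficients of the method.\<close>

record imex_mri_sr =
  slow_stages :: nat
  n_Omega :: nat
  Omega :: "nat \<Rightarrow> real mat"
  Gamma :: "real mat"
  slow_c :: "real vec"

record runge_kutta =
  fast_stages :: nat
  fast_A :: "real mat"
  fast_b :: "real vec"
  fast_c :: "real vec"

definition is_imex_mri_sr :: "imex_mri_sr \<Rightarrow> bool" where
  "is_imex_mri_sr M \<longleftrightarrow>
     n_Omega M \<ge> 1 \<and>
     (\<forall>k<n_Omega M. Omega M k \<in> carrier_mat (slow_stages M) (slow_stages M) \<and>
        strictly_lower_triangular (Omega M k)) \<and>
     Gamma M \<in> carrier_mat (slow_stages M) (slow_stages M) \<and>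
     lower_triangular (Gamma M) \<and>
     (\<forall>j<slow_stages M. Gamma M $$ (0, j) = 0) \<and>
     slow_c M \<in> carrier_vec (slow_stages M)"

definition is_runge_kutta :: "runge_kutta \<Rightarrow> bool" where
  "is_runge_kutta R \<longleftrightarrow>
     fast_A R \<in> carrier_mat (fast_stages R) (fast_stages R) \<and>
     fast_b R \<in> carrier_vec (fast_stages R) \<and>
     fast_c R \<in> carrier_vec (fast_stages R) \<and>
     fast_c R = fast_A R *\<^sub>v ones_vec (fast_stages R)"

definition bushy_tree_conditions :: "runge_kutta \<Rightarrow> nat \<Rightarrow> bool" where
  "bushy_tree_conditions R n \<longleftrightarrow>
     (\<forall>k<n. fast_b R \<bullet> vec_pow (fast_c R) k = 1 / (real k + 1))"

definition Omega_bar :: "imex_mri_sr \<Rightarrow> real mat" where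
  "Omega_bar M = mat_sum (slow_stages M) (slow_stages M)
     (\<lambda>k. (1 / (real k + 1)) \<cdot>\<^sub>m Omega M k) (n_Omega M)"

definition slow_C :: "imex_mri_sr \<Rightarrow> real mat" where
  "slow_C M = mat_diag (slow_stages M) (\<lambda>i. slow_c M $ i)"

section \<open>GARK matrices and internal consistency\<close>

definition A_FF :: "imex_mri_sr \<Rightarrow> runge_kutta \<Rightarrow> real mat" where
  "A_FF M R = kronecker (slow_C M) (fast_A R)"

definition A_FE :: "imex_mri_sr \<Rightarrow> runge_kutta \<Rightarrow> real mat" where
  "A_FE M R = mat_sum (slow_stages M * fast_stages R) (slow_stages M)
     (\<lambda>k. kronecker (Omega M k) (col_mat (fast_A R *\<^sub>v vec_pow (fast_c R) k))) (n_Omega M)"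

definition A_FI :: "imex_mri_sr \<Rightarrow> runge_kutta \<Rightarrow> real mat" where
  "A_FI M R = A_FE M R"

definition A_SF :: "imex_mri_sr \<Rightarrow> runge_kutta \<Rightarrow> real mat" where
  "A_SF M R = kronecker (slow_C M) (mat_of_row (fast_b R))"

definition A_SE :: "imex_mri_sr \<Rightarrow> real mat" where
  "A_SE M = Omega_bar M"

definition A_SI :: "imex_mri_sr \<Rightarrow> real mat" where
  "A_SI M = Omega_bar M + Gamma M"

definition gark_internally_consistent :: "imex_mri_sr \<Rightarrow> runge_kutta \<Rightarrow> bool" where
  "gark_internally_consistent M R \<longleftrightarrow>
     row_sums (A_FF M R) = row_sums (A_FE M R) \<and>
     row_sums (A_FE M R) = row_sums (A_FI M R) \<and>
     row_sums (A_SF M R) = row_sums (A_SE M) \<and>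
     row_sums (A_SE M) = row_sums (A_SI M)"

end

theory Submission
  imports Defs
begin

text \<open>Row sums are additive and multiplicative with respect to the Kronecker product. The conditions
  on the row sums of \<open>Omega M k\<close> therefore leave only the summand \<open>k = 0\<close>, for which the fast factor
  \<open>fast_A R *\<^sub>v vec_pow (fast_c R) 0\<close> is the vector of row sums of \<open>fast_A R\<close>. The
  bushy-tree condition for \<open>k = 0\<close> says that the entries of \<open>fast_b R\<close> sum to 1.\<close>

lemma dim_row_sums [simp]: "dim_vec (row_sums A) = dim_row A"
  by (simp add: row_sums_def)

text \<open>Links the hypotheses, phrased as products with the vector of ones, to the row sums in
  the consistency conditions.\<close>

lemma row_sums_eq_mult_ones:
  assumes "A \<in> carrier_mat m n"
  shows "row_sums A = A *\<^sub>v ones_vec n"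
  using assms
  by (intro eq_vecI) (auto simp: row_sums_def ones_vec_def scalar_prod_def lessThan_atLeast0)

lemma vec_pow_0: "vec_pow v 0 = ones_vec (dim_vec v)"
  by (intro eq_vecI) (simp_all add: vec_pow_def ones_vec_def)

lemma row_sums_add:
  assumes "A \<in> carrier_mat m n" "B \<in> carrier_mat m n"
  shows "row_sums (A + B) = row_sums A + row_sums B"
  using assms by (intro eq_vecI) (auto simp: row_sums_def sum.distrib)

lemma row_sums_smult: "row_sums (a \<cdot>\<^sub>m A) = a \<cdot>\<^sub>v row_sums A"
  by (intro eq_vecI) (auto simp: row_sums_def sum_distrib_left)

lemma dim_mat_sum [simp]:
  "dim_row (mat_sum m n f K) = m" "dim_col (mat_sum m n f K) = n"
  by (simp_all add: mat_sum_def)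

text \<open>Interchange of the sums over \<open>k\<close> and over columns. The carrier assumption
  makes every \<open>row_sums (f k)\<close> run over the same \<open>n\<close> columns.\<close>

lemma row_sums_mat_sum:
  assumes "\<And>k. k < K \<Longrightarrow> f k \<in> carrier_mat m n" "i < m"
  shows "row_sums (mat_sum m n f K) $ i = (\<Sum>k<K. row_sums (f k) $ i)"
proof -
  have "row_sums (mat_sum m n f K) $ i = (\<Sum>k<K. \<Sum>j<n. f k $$ (i, j))"
    using assms(2) by (simp add: row_sums_def mat_sum_def) (rule sum.swap)
  also have "\<dots> = (\<Sum>k<K. row_sums (f k) $ i)"
  proof (rule sum.cong[OF refl])
    fix k assume "k \<in> {..<K}"
    then have "f k \<in> carrier_mat m n" using assms(1) by simp
    then show "(\<Sum>j<n. f k $$ (i, j)) = row_sums (f k) $ i"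
      using assms(2) by (auto simp: row_sums_def)
  qed
  finally show ?thesis .
qed

text \<open>Cut the range into \<open>m\<close> consecutive blocks of length \<open>n\<close>: on
  block \<open>a\<close> the quotient is constantly \<open>a\<close>, while the remainder runs
  through all \<open>b < n\<close>. For \<open>n = 0\<close> both sides vanish.\<close>

lemma sum_div_mod_product:
  fixes f g :: "nat \<Rightarrow> 'a :: comm_semiring_0"
  shows "(\<Sum>j<m * n. f (j div n) * g (j mod n)) = (\<Sum>a<m. f a) * (\<Sum>b<n. g b)"
proof -
  have "(\<Sum>j<m * n. f (j div n) * g (j mod n))
      = (\<Sum>a<m. \<Sum>j = a * n..<a * n + n. f (j div n) * g (j mod n))"
    by (rule sum.nat_group[symmetric])
  also have "\<dots> = (\<Sum>a<m. \<Sum>b<n. f a * g b)"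
  proof (rule sum.cong[OF refl])
    fix a
    have "(\<Sum>j = a * n..<a * n + n. f (j div n) * g (j mod n))
        = (\<Sum>b<n. f ((b + a * n) div n) * g ((b + a * n) mod n))"
      using sum.shift_bounds_nat_ivl[of "\<lambda>j. f (j div n) * g (j mod n)" 0 "a * n" n]
      by (simp add: lessThan_atLeast0 add.commute)
    also have "\<dots> = (\<Sum>b<n. f a * g b)"
      by (intro sum.cong) auto
    finally show "(\<Sum>j = a * n..<a * n + n. f (j div n) * g (j mod n)) = (\<Sum>b<n. f a * g b)" .
  qed
  also have "\<dots> = (\<Sum>a<m. f a) * (\<Sum>b<n. g b)"
    by (simp add: sum_product)
  finally show ?thesis .
qed

lemma dim_kronecker [simp]:
  "dim_row (kronecker A B) = dim_row A * dim_row B"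
  "dim_col (kronecker A B) = dim_col A * dim_col B"
  by (simp_all add: kronecker_def)

text \<open>Row \<open>i\<close> of the product consists of all products of an entry from row
  \<open>i div dim_row B\<close> of \<open>A\<close> and one from row \<open>i mod dim_row B\<close>
  of \<open>B\<close>, so its sum factors. The bound on \<open>i\<close> forces
  \<open>dim_row B > 0\<close>, which keeps the remainder in range.\<close>

lemma row_sums_kronecker:
  assumes "i < dim_row A * dim_row B"
  shows "row_sums (kronecker A B) $ i
    = row_sums A $ (i div dim_row B) * row_sums B $ (i mod dim_row B)"
proof -
  have "i div dim_row B < dim_row A" "i mod dim_row B < dim_row B"
    using assms by (auto simp: less_mult_imp_div_less intro!: mod_less_divisor gr0I)
  then show ?thesis
    using assms
      sum_div_mod_product[where f = "\<lambda>j. A $$ (i div dim_row B, j)"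
        and g = "\<lambda>j. B $$ (i mod dim_row B, j)"]
    by (simp add: row_sums_def kronecker_def)
qed

lemma dim_col_mat [simp]: "dim_row (col_mat v) = dim_vec v" "dim_col (col_mat v) = 1"
  by (simp_all add: col_mat_def)

lemma row_sums_col_mat: "row_sums (col_mat v) = v"
  by (intro eq_vecI) (auto simp: row_sums_def col_mat_def mat_of_cols_def)

lemma row_sums_mat_of_row: "row_sums (mat_of_row v) = vec 1 (\<lambda>_. v \<bullet> ones_vec (dim_vec v))"
  by (intro eq_vecI)
     (auto simp: row_sums_def mat_of_row_def scalar_prod_def ones_vec_def lessThan_atLeast0)

lemma row_sums_mat_diag: "row_sums (mat_diag n f) = vec n f"
  by (intro eq_vecI) (auto simp: row_sums_def mat_diag_def)

text \<open>Every summand with \<open>k\<close> at least 1 has a vanishing row sum. The weight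
  \<open>w\<close> is left arbitrary so that the lemma serves both the fast rows, with entries of
  \<open>fast_A R *\<^sub>v vec_pow (fast_c R) k\<close>, and the slow rows, with 1 / (k +
  1).\<close>

lemma sum_row_sums_Omega:
  assumes "is_imex_mri_sr M"
    and "Omega M 0 *\<^sub>v ones_vec (slow_stages M) = slow_c M"
    and "\<And>k. 1 \<le> k \<Longrightarrow> k \<le> n_Omega M - 1 \<Longrightarrow>
           Omega M k *\<^sub>v ones_vec (slow_stages M) = 0\<^sub>v (slow_stages M)"
    and "i < slow_stages M"
  shows "(\<Sum>k<n_Omega M. row_sums (Omega M k) $ i * w k) = slow_c M $ i * w 0"
proof -
  have Omega: "row_sums (Omega M k) = Omega M k *\<^sub>v ones_vec (slow_stages M)"
    if "k < n_Omega M" for k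
    using assms(1) that by (auto simp: is_imex_mri_sr_def intro!: row_sums_eq_mult_ones)
  have n: "n_Omega M > 0"
    using assms(1) by (simp add: is_imex_mri_sr_def)
  have "(\<Sum>k<n_Omega M. row_sums (Omega M k) $ i * w k)
      = (\<Sum>k<n_Omega M. if k = 0 then slow_c M $ i * w 0 else 0)"
    using Omega assms(2-4) by (intro sum.cong) auto
  also have "\<dots> = slow_c M $ i * w 0"
    \<comment> \<open>Positivity of \<open>n_Omega M\<close> puts the index 0 into the range of
      summation.\<close>
    using n by (simp add: sum.delta)
  finally show ?thesis .
qed

theorem theorem2p3:
  fixes M :: imex_mri_sr and R :: runge_kutta
  assumes "is_imex_mri_sr M"
    and "is_runge_kutta R"
    and "bushy_tree_conditions R (n_Omega M)"
    and "Omega M 0 *\<^sub>v ones_vec (slow_stages M) = slow_c M"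
    and "\<And>k. 1 \<le> k \<Longrightarrow> k \<le> n_Omega M - 1 \<Longrightarrow>
           Omega M k *\<^sub>v ones_vec (slow_stages M) = 0\<^sub>v (slow_stages M)"
    and "Gamma M *\<^sub>v ones_vec (slow_stages M) = 0\<^sub>v (slow_stages M)"
  shows "gark_internally_consistent M R"
proof -
  let ?s = "slow_stages M" and ?t = "fast_stages R"
  have n: "n_Omega M > 0" and c: "slow_c M \<in> carrier_vec ?s"
    and Omega: "\<And>k. k < n_Omega M \<Longrightarrow> Omega M k \<in> carrier_mat ?s ?s"
    and Gamma: "Gamma M \<in> carrier_mat ?s ?s"
    using assms(1) by (auto simp: is_imex_mri_sr_def)
  have A: "fast_A R \<in> carrier_mat ?t ?t" and b: "fast_b R \<in> carrier_vec ?t"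
    and cF: "fast_c R \<in> carrier_vec ?t"
    using assms(2) by (auto simp: is_runge_kutta_def)
  have b_sum: "fast_b R \<bullet> ones_vec ?t = 1"
    using assms(3) n cF vec_pow_0[of "fast_c R"] unfolding bushy_tree_conditions_def by force
  have A_ones: "fast_A R *\<^sub>v vec_pow (fast_c R) 0 = row_sums (fast_A R)"
    using cF by (simp add: vec_pow_0 row_sums_eq_mult_ones[OF A])
  have C: "row_sums (slow_C M) = slow_c M" "dim_row (slow_C M) = ?s"
    using c by (auto simp: slow_C_def row_sums_mat_diag mat_diag_dim[THEN carrier_matD(1)])
  have FE: "row_sums (A_FF M R) = row_sums (A_FE M R)"
  proof (rule eq_vecI)
    fix i assume "i < dim_vec (row_sums (A_FE M R))"
    then have i: "i < ?s * ?t" by (simp add: A_FE_def)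
    \<comment> \<open>A row index \<open>i\<close> of the fast block encodes the slow stage
      \<open>i div ?t\<close> and the fast stage \<open>i mod ?t\<close>.\<close>
    then have id: "i div ?t < ?s" by (simp add: less_mult_imp_div_less)
    let ?v = "\<lambda>k. fast_A R *\<^sub>v vec_pow (fast_c R) k"
    let ?K = "\<lambda>k. kronecker (Omega M k) (col_mat (?v k))"
    have carrier: "?K k \<in> carrier_mat (?s * ?t) ?s" if "k < n_Omega M" for k
      using Omega[OF that] A by (intro carrier_matI) auto
    have entry: "row_sums (?K k) $ i = row_sums (Omega M k) $ (i div ?t) * ?v k $ (i mod ?t)"
      if "k < n_Omega M" for k
    proof -
      have "dim_row (Omega M k) = ?s" "dim_row (col_mat (?v k)) = ?t"
        using Omega[OF that] A by auto
      then show ?thesis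
        using row_sums_kronecker[of i "Omega M k" "col_mat (?v k)"] i
        by (simp only: row_sums_col_mat)
    qed
    have "row_sums (A_FE M R) $ i = (\<Sum>k<n_Omega M. row_sums (?K k) $ i)"
      unfolding A_FE_def using carrier i by (rule row_sums_mat_sum)
    also have "\<dots> = (\<Sum>k<n_Omega M. row_sums (Omega M k) $ (i div ?t) * ?v k $ (i mod ?t))"
      using entry by (intro sum.cong) auto
    also have "\<dots> = slow_c M $ (i div ?t) * row_sums (fast_A R) $ (i mod ?t)"
      \<comment> \<open>Here \<open>w k\<close> is \<open>?v k $ (i mod ?t)\<close>, and
        \<open>A_ones\<close> identifies \<open>w 0\<close> with a row sum of
        \<open>fast_A R\<close>.\<close>
      using sum_row_sums_Omega[OF assms(1,4,5) id] by (simp only: A_ones)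
    also have "\<dots> = row_sums (A_FF M R) $ i"
      using row_sums_kronecker[of i "slow_C M" "fast_A R"] A i C by (simp add: A_FF_def)
    finally show "row_sums (A_FF M R) $ i = row_sums (A_FE M R) $ i" by simp
  next
    show "dim_vec (row_sums (A_FF M R)) = dim_vec (row_sums (A_FE M R))"
      using A C by (simp add: A_FF_def A_FE_def)
  qed
  \<comment> \<open>All three slow row sum vectors are shown to have the common value
    \<open>slow_c M\<close>.\<close>
  have SE: "row_sums (A_SE M) = slow_c M"
  proof (rule eq_vecI)
    fix i assume "i < dim_vec (slow_c M)"
    then have i: "i < ?s" using c by simp
    have "row_sums (A_SE M) $ i = (\<Sum>k<n_Omega M. row_sums ((1 / (real k + 1)) \<cdot>\<^sub>m Omega M k) $ i)"
      unfolding A_SE_def Omega_bar_def using Omega i by (intro row_sums_mat_sum) auto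
    also have "\<dots> = (\<Sum>k<n_Omega M. row_sums (Omega M k) $ i * (1 / (real k + 1)))"
    proof (rule sum.cong[OF refl])
      fix k assume "k \<in> {..<n_Omega M}"
      then have "dim_row (Omega M k) = ?s" using Omega by auto
      then show "row_sums ((1 / (real k + 1)) \<cdot>\<^sub>m Omega M k) $ i
          = row_sums (Omega M k) $ i * (1 / (real k + 1))"
        using i by (simp add: row_sums_smult)
    qed
    also have "\<dots> = slow_c M $ i"
      \<comment> \<open>The surviving weight is 1 / (0 + 1) = 1.\<close>
      using sum_row_sums_Omega[OF assms(1,4,5) i, of "\<lambda>k. 1 / (real k + 1)"] by simp
    finally show "row_sums (A_SE M) $ i = slow_c M $ i" .
  qed (use c in \<open>simp add: A_SE_def Omega_bar_def\<close>)
  have SF: "row_sums (A_SF M R) = slow_c M"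
  proof (rule eq_vecI)
    fix i assume "i < dim_vec (slow_c M)"
    then show "row_sums (A_SF M R) $ i = slow_c M $ i"
      \<comment> \<open>The second factor has a single row, so \<open>i div 1 = i\<close> and
        \<open>i mod 1 = 0\<close>; its only row sum is 1 by \<open>b_sum\<close>.\<close>
      using row_sums_kronecker[of i "slow_C M" "mat_of_row (fast_b R)"] c b C b_sum
      by (simp add: A_SF_def row_sums_mat_of_row)
  qed (use c C in \<open>simp add: A_SF_def\<close>)
  have "row_sums (A_SI M) = row_sums (A_SE M) + row_sums (Gamma M)"
    unfolding A_SI_def A_SE_def
    by (rule row_sums_add[OF _ Gamma]) (simp add: Omega_bar_def carrier_matI)
  then have SI: "row_sums (A_SI M) = slow_c M"
    using SE c assms(6) by (simp add: row_sums_eq_mult_ones[OF Gamma])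
  show ?thesis
    using FE SE SF SI by (simp add: gark_internally_consistent_def A_FI_def)
qed

end
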